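(* Let $T\in\mathcal{M}_n$. Then $\begin{bmatrix} |T| & T^*\\ T & |T|\end{bmatrix}$ is positive semidefinite if and only if $T$ is semi-hyponormal.
   Context: $\mathcal{M}_n$ is the algebra of $n\times n$ complex matrices; $|T|=(T^*T)^{1/2}$ and $|T^*|=(TT^* )^{1/2}$. For Hermitian matrices, $A\le B$ means $B-A$ is positive semidefinite. $T$ is semi-hyponormal if $|T^*|\le|T|$. *)

theory Defs
  imports "Jordan_Normal_Form.Schur_Decomposition"
begin

definition hermitian_mat :: "complex mat \<Rightarrow> bool" where
  "hermitian_mat A \<longleftrightarrow> mat_adjoint A = A"

(* (A *v x) \<bullet>c x is the Hermitian form x* A x. The order on complex is that of
   HOL-Library.Complex_Order, so "0 <= z" says that z is real and nonnegative. *)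
definition psd_mat :: "complex mat \<Rightarrow> bool" where
  "psd_mat A \<longleftrightarrow> hermitian_mat A \<and>
     (\<forall>x \<in> carrier_vec (dim_row A). 0 \<le> (A *\<^sub>v x) \<bullet>c x)"

definition loewner_le :: "complex mat \<Rightarrow> complex mat \<Rightarrow> bool" where
  "loewner_le A B \<longleftrightarrow> hermitian_mat A \<and> hermitian_mat B \<and>
     dim_row A = dim_row B \<and> psd_mat (B - A)"

(* Meaningful for positive semidefinite A, which have exactly one positive
   semidefinite square root. *)
definition psd_sqrt :: "complex mat \<Rightarrow> complex mat" where
  "psd_sqrt A = (THE B. psd_mat B \<and> B * B = A)"

definition mat_abs :: "complex mat \<Rightarrow> complex mat" where
  "mat_abs T = psd_sqrt (mat_adjoint T * T)"

definition semi_hyponormal :: "complex mat \<Rightarrow> bool" where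
  "semi_hyponormal T \<longleftrightarrow> loewner_le (mat_abs (mat_adjoint T)) (mat_abs T)"

end

theory Submission
  imports Defs "Jordan_Normal_Form.Jordan_Normal_Form_Existence"
begin

text \<open>Write \<open>P = |T|\<close>, \<open>Q = |T*|\<close>, \<open>D = diag(P, Q)\<close> and \<open>K = [[0, T*], [T, 0]]\<close>. Then \<open>K\<close> is Hermitian
  and \<open>D\<^sup>2 = K\<^sup>2\<close>, so \<open>D = |K|\<close>. Hence \<open>D + K = [[P, T*], [T, Q]]\<close> is positive semidefinite, and
  adding \<open>diag(0, P - Q)\<close> gives one implication. Moreover \<open>D\<close> commutes with \<open>K\<close>, so \<open>P T* = T* Q\<close>.
  For the converse, test the block matrix on \<open>(- T* Z y, y)\<close>, where \<open>Z\<close> is a generalized inverse of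
  \<open>Q\<close>: the value is \<open>\<langle>(P - Q) y, y\<rangle>\<close>. The vector \<open>- T* Z y\<close> plays the role of \<open>- U* y\<close> for a polar
  decomposition \<open>T = U P\<close>.\<close>

section \<open>Algebra of the conjugate transpose and its relation to the inner product\<close>

lemma dim_mat_adjoint [simp]:
  "dim_row (mat_adjoint A) = dim_col A" "dim_col (mat_adjoint A) = dim_row A"
  by (auto simp: mat_adjoint_def)

lemma mat_adjoint_carrier [simp]:
  "A \<in> carrier_mat n m \<Longrightarrow> mat_adjoint A \<in> carrier_mat m n"
  by (intro carrier_matI) auto

lemma index_mat_adjoint [simp]:
  assumes "i < dim_col A" "j < dim_row A"
  shows "mat_adjoint A $$ (i, j) = conjugate (A $$ (j, i))"
  using assms by (simp add: mat_adjoint_def mat_of_rows_def)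

lemma mat_adjoint_adjoint [simp]: "mat_adjoint (mat_adjoint A) = A"
  by (intro eq_matI) auto

lemma mat_adjoint_zero [simp]: "mat_adjoint (0\<^sub>m n m) = 0\<^sub>m m n"
  by (intro eq_matI) auto

lemma mat_adjoint_one [simp]: "mat_adjoint (1\<^sub>m n) = (1\<^sub>m n :: complex mat)"
  by (intro eq_matI) auto

lemma mat_adjoint_add:
  assumes "A \<in> carrier_mat n m" "B \<in> carrier_mat n m"
  shows "mat_adjoint (A + B) = mat_adjoint A + mat_adjoint B"
  using assms by (intro eq_matI) (auto simp: conjugate_dist_add)

lemma mat_adjoint_uminus: "mat_adjoint (- A) = - mat_adjoint A"
  by (intro eq_matI) (auto simp: conjugate_neg)

lemma mat_adjoint_minus:
  assumes "A \<in> carrier_mat n m" "B \<in> carrier_mat n m"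
  shows "mat_adjoint (A - B) = mat_adjoint A - mat_adjoint B"
  using assms
  by (simp add: minus_add_uminus_mat[of _ n m] mat_adjoint_add[of _ n m] mat_adjoint_uminus
      minus_add_uminus_mat[of _ m n])

lemma mat_adjoint_mult:
  assumes "A \<in> carrier_mat n m" "B \<in> carrier_mat m k"
  shows "mat_adjoint (A * B) = mat_adjoint B * mat_adjoint A"
proof (rule eq_matI)
  fix i j assume "i < dim_row (mat_adjoint B * mat_adjoint A)"
    "j < dim_col (mat_adjoint B * mat_adjoint A)"
  with assms have ij: "i < k" "j < n" by auto
  show "mat_adjoint (A * B) $$ (i, j) = (mat_adjoint B * mat_adjoint A) $$ (i, j)"
    using assms ij
    by (auto simp: scalar_prod_def sum_conjugate conjugate_dist_mul mult.commute intro!: sum.cong)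
qed (use assms in auto)

lemma mat_adjoint_four_block:
  assumes "A \<in> carrier_mat n1 m1" "B \<in> carrier_mat n1 m2"
    "C \<in> carrier_mat n2 m1" "D \<in> carrier_mat n2 m2"
  shows "mat_adjoint (four_block_mat A B C D) =
    four_block_mat (mat_adjoint A) (mat_adjoint C) (mat_adjoint B) (mat_adjoint D)"
  using assms by (intro eq_matI) auto

lemma cscalar_prod_adjoint:
  assumes A: "A \<in> carrier_mat n m" and x: "x \<in> carrier_vec m" and y: "y \<in> carrier_vec n"
  shows "(A *\<^sub>v x) \<bullet>c y = x \<bullet>c (mat_adjoint A *\<^sub>v y)"
proof -
  have "(A *\<^sub>v x) \<bullet>c y = (\<Sum>i<n. \<Sum>j<m. A $$ (i, j) * x $ j * conjugate (y $ i))"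
    using A x y by (simp add: scalar_prod_def sum_distrib_right atLeast0LessThan)
  also have "\<dots> = (\<Sum>j<m. \<Sum>i<n. A $$ (i, j) * x $ j * conjugate (y $ i))"
    by (rule sum.swap)
  also have "\<dots> = x \<bullet>c (mat_adjoint A *\<^sub>v y)"
    using A x y
    by (simp add: scalar_prod_def sum_distrib_left atLeast0LessThan sum_conjugate
        conjugate_dist_mul ac_simps)
  finally show ?thesis .
qed

section \<open>Elementary facts on Hermitian matrices\<close>

lemma hermitian_matD: "hermitian_mat A \<Longrightarrow> mat_adjoint A = A"
  by (simp add: hermitian_mat_def)

text \<open>Taking the adjoint swaps the two dimensions. This recovers a carrier for matrices known
  only to be Hermitian, such as the candidates in the definition of \<open>psd_sqrt\<close>.\<close>

lemma hermitian_mat_square: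
  assumes "hermitian_mat A"
  shows "A \<in> carrier_mat (dim_row A) (dim_row A)"
  using hermitian_matD[OF assms] by (metis carrier_matI dim_mat_adjoint(2))

lemma hermitian_mat_add:
  assumes "A \<in> carrier_mat n n" "B \<in> carrier_mat n n" "hermitian_mat A" "hermitian_mat B"
  shows "hermitian_mat (A + B)"
  using assms by (simp add: hermitian_mat_def mat_adjoint_add[of _ n n])

lemma hermitian_mat_minus:
  assumes "A \<in> carrier_mat n n" "B \<in> carrier_mat n n" "hermitian_mat A" "hermitian_mat B"
  shows "hermitian_mat (A - B)"
  using assms by (simp add: hermitian_mat_def mat_adjoint_minus[of _ n n])

lemma hermitian_mat_uminus: "hermitian_mat A \<Longrightarrow> hermitian_mat (- A)"
  by (simp add: hermitian_mat_def mat_adjoint_uminus)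

lemma hermitian_cscalar_prod:
  assumes "A \<in> carrier_mat n n" "hermitian_mat A" "x \<in> carrier_vec n" "y \<in> carrier_vec n"
  shows "(A *\<^sub>v x) \<bullet>c y = x \<bullet>c (A *\<^sub>v y)"
  using cscalar_prod_adjoint[OF assms(1,3,4)] assms(2) by (simp add: hermitian_mat_def)

text \<open>Moving \<open>A\<close> across the inner product of \<open>A v\<close> with
  \<open>v\<close> turns \<open>k\<close> into \<open>cnj k\<close>, and the norm of
  \<open>v\<close> can be cancelled.\<close>

lemma hermitian_eigenvalue_real:
  assumes A: "A \<in> carrier_mat n n" "hermitian_mat A"
    and v: "v \<in> carrier_vec n" "v \<noteq> 0\<^sub>v n" and ev: "A *\<^sub>v v = k \<cdot>\<^sub>v v"
  shows "k \<in> \<real>"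
proof -
  have "k * (v \<bullet>c v) = cnj k * (v \<bullet>c v)"
    using hermitian_cscalar_prod[OF A v(1) v(1)] v by (simp add: ev conjugate_smult_vec)
  moreover have "v \<bullet>c v \<noteq> 0" using v by simp
  ultimately show ?thesis by (simp add: Reals_cnj_iff)
qed

section \<open>Diagonalization of Hermitian matrices through the Jordan normal form\<close>

text \<open>A nonzero off-diagonal entry lies on the superdiagonal inside a single Jordan block,
  where the diagonal is constant. The induction peels off the first block.\<close>

lemma jordan_matrix_nonzero_entry:
  fixes n_as :: "(nat \<times> 'a :: {zero,one}) list"
  assumes "i < sum_list (map fst n_as)" "j < sum_list (map fst n_as)"
    and "jordan_matrix n_as $$ (i, j) \<noteq> 0" "i \<noteq> j"
  shows "j = Suc i \<and> jordan_matrix n_as $$ (i, i) = jordan_matrix n_as $$ (j, j)"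
  using assms
proof (induction n_as arbitrary: i j)
  case (Cons na n_as)
  obtain m a where na: "na = (m, a)" by force
  let ?N = "sum_list (map fst n_as)"
  have J: "jordan_matrix ((m, a) # n_as) =
    four_block_mat (jordan_block m a) (0\<^sub>m m ?N) (0\<^sub>m ?N m) (jordan_matrix n_as)"
    using jordan_matrix_dim[of n_as] unfolding jordan_matrix_def by (simp add: Let_def)
  note prems = Cons.prems[unfolded na, unfolded J]
  \<comment> \<open>The off-diagonal blocks of \<open>J\<close> vanish, so both indices fall in the
    first block or both fall beyond it.\<close>
  have "(i < m \<and> j < m) \<or> (\<not> i < m \<and> \<not> j < m)"
    using prems by (auto split: if_splits)
  then show ?case
  proof
    assume "i < m \<and> j < m"
    then show ?thesis using prems unfolding na J by (auto split: if_splits)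
  next
    assume ij: "\<not> i < m \<and> \<not> j < m"
    with prems have "j - m = Suc (i - m) \<and>
      jordan_matrix n_as $$ (i - m, i - m) = jordan_matrix n_as $$ (j - m, j - m)"
      by (intro Cons.IH) auto
    with ij prems show ?thesis unfolding na J by auto
  qed
qed simp

text \<open>A Jordan block of size at least two would give \<open>A p = l p\<close> and \<open>A q = c p + l q\<close> with \<open>l\<close> real
  and \<open>c, p\<close> nonzero; pairing the second equation with \<open>p\<close> yields \<open>c \<langle>p, p\<rangle> = 0\<close>.\<close>
lemma hermitian_diagonalizable:
  assumes A: "A \<in> carrier_mat n n" "hermitian_mat A"
  obtains P Q b where "P \<in> carrier_mat n n" "Q \<in> carrier_mat n n"
    "P * Q = 1\<^sub>m n" "Q * P = 1\<^sub>m n" "A = P * mat_diag n (\<lambda>i. complex_of_real (b i)) * Q"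
    "\<And>i. i < n \<Longrightarrow> eigenvalue A (complex_of_real (b i))"
proof -
  obtain as where "char_poly A = (\<Prod>a\<leftarrow>as. [:- a, 1:])"
    using char_poly_factorized[OF A(1)] by blast
  then obtain n_as where "similar_mat A (jordan_matrix n_as)"
    using jordan_nf_exists[OF A(1)] by (auto simp: jordan_nf_def)
  then obtain P Q where "similar_mat_wit A (jordan_matrix n_as) P Q"
    by (auto simp: similar_mat_def)
  define J where "J = jordan_matrix n_as"
  note w = similar_mat_witD2[OF A(1) \<open>similar_mat_wit A _ P Q\<close>, folded J_def]
  note [simp] = w(4-7)
  have N: "sum_list (map fst n_as) = n"
    using w(5) unfolding J_def by (metis carrier_matD(1) jordan_matrix_dim(1))
  have Jent: "j = Suc i \<and> J $$ (i, i) = J $$ (j, j)"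
    if "i < n" "j < n" "J $$ (i, j) \<noteq> 0" "i \<noteq> j" for i j
    using jordan_matrix_nonzero_entry[of i n_as j] that by (simp add: N J_def)
  have J0: "J $$ (k, l) = 0" if "k < n" "l < n" "k \<noteq> l" "l \<noteq> Suc k" for k l
    using Jent that by blast
  \<comment> \<open>The columns of \<open>P\<close>, that is, the Jordan basis.\<close>
  define p where "p i = P *\<^sub>v unit_vec n i" for i
  have p [simp]: "p i \<in> carrier_vec n" for i by (simp add: p_def mult_mat_vec_carrier[of _ n n])
  have p0: "p i \<noteq> 0\<^sub>v n" if "i < n" for i
  proof
    assume "p i = 0\<^sub>v n"
    then have "Q *\<^sub>v (P *\<^sub>v unit_vec n i) = 0\<^sub>v n"
      using carrier_matD[OF w(7)] by (intro eq_vecI) (auto simp: p_def)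
    then have "unit_vec n i = (0\<^sub>v n :: complex vec)"
      using assoc_mult_mat_vec[OF w(7) w(6) unit_vec_carrier[of n i]] w(2) by simp
    then show False using that by (metis index_unit_vec(1) index_zero_vec(1) zero_neq_one)
  qed
  have Ap: "A *\<^sub>v p i = P *\<^sub>v col J i" if "i < n" for i
  proof -
    have "A *\<^sub>v p i = P *\<^sub>v (J *\<^sub>v (Q *\<^sub>v (P *\<^sub>v unit_vec n i)))"
      by (simp add: p_def w(3) assoc_mult_mat_vec[of _ n n _ n] mult_carrier_mat[of _ n n _ n]
          mult_mat_vec_carrier[of _ n n])
    also have "Q *\<^sub>v (P *\<^sub>v unit_vec n i) = unit_vec n i"
      using assoc_mult_mat_vec[OF w(7) w(6) unit_vec_carrier[of n i]] w(2) by simp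
    also have "J *\<^sub>v unit_vec n i = col J i"
      using that w(5) col_mult2[of J n n "1\<^sub>m n" n i] right_mult_one_mat[OF w(5)]
      by simp
    finally show ?thesis .
  qed
  have eig: "A *\<^sub>v p i = J $$ (i, i) \<cdot>\<^sub>v p i"
    if "i < n" "\<And>k. Suc k = i \<Longrightarrow> J $$ (k, i) = 0" for i
  proof -
    have "col J i = J $$ (i, i) \<cdot>\<^sub>v unit_vec n i"
    proof (rule eq_vecI)
      fix k assume "k < dim_vec (J $$ (i, i) \<cdot>\<^sub>v unit_vec n i)"
      then show "col J i $ k = (J $$ (i, i) \<cdot>\<^sub>v unit_vec n i) $ k"
        using that carrier_matD[OF w(5)] J0[of k i] by (cases "Suc k = i") (auto simp: unit_vec_def)
    qed (use carrier_matD[OF w(5)] in auto)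
    then show ?thesis using Ap[OF that(1)] by (simp add: p_def mult_mat_vec[of _ n n])
  qed
  \<comment> \<open>Strong induction from the left: the earlier superdiagonal entries vanish, so
    \<open>p i\<close> is an eigenvector, and a nonzero entry here would make \<open>p i\<close>,
    \<open>p (Suc i)\<close> the start of a Jordan chain.\<close>
  have super: "J $$ (i, Suc i) = 0" if "Suc i < n" for i
    using that
  proof (induction i rule: less_induct)
    case (less i)
    then have i: "i < n" by simp
    have ev: "A *\<^sub>v p i = J $$ (i, i) \<cdot>\<^sub>v p i" using less by (intro eig) auto
    define c l where "c = J $$ (i, Suc i)" and "l = J $$ (i, i)"
    show ?case
    proof (rule ccontr)
      assume nz: "J $$ (i, Suc i) \<noteq> 0"
      then have l': "J $$ (Suc i, Suc i) = l" using Jent[of i "Suc i"] less.prems by (simp add: l_def)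
      have "col J (Suc i) = c \<cdot>\<^sub>v unit_vec n i + l \<cdot>\<^sub>v unit_vec n (Suc i)"
        (is "_ = ?r")
      proof (rule eq_vecI)
        fix k assume "k < dim_vec ?r"
        then show "col J (Suc i) $ k = ?r $ k"
          using less.prems carrier_matD[OF w(5)] l' J0[of k "Suc i"]
          by (cases "k = i \<or> k = Suc i") (auto simp: unit_vec_def c_def)
      qed (use carrier_matD[OF w(5)] in auto)
      then have "A *\<^sub>v p (Suc i) = c \<cdot>\<^sub>v p i + l \<cdot>\<^sub>v p (Suc i)"
        using Ap[OF less.prems]
        by (simp add: p_def mult_mat_vec[of _ n n] mult_add_distrib_mat_vec[of _ n n])
      then have "(A *\<^sub>v p (Suc i)) \<bullet>c p i = c * (p i \<bullet>c p i) + l * (p (Suc i) \<bullet>c p i)"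
        by (simp add: add_scalar_prod_distrib[of _ n] smult_scalar_prod_distrib[of _ n])
      moreover have "(A *\<^sub>v p (Suc i)) \<bullet>c p i = cnj l * (p (Suc i) \<bullet>c p i)"
        using hermitian_cscalar_prod[OF A p p, of "Suc i" i] ev
        by (simp add: l_def conjugate_smult_vec scalar_prod_smult_distrib[of _ n])
      moreover have "cnj l = l"
        using hermitian_eigenvalue_real[OF A p p0[OF i] ev] by (simp add: l_def Reals_cnj_iff)
      ultimately have "c * (p i \<bullet>c p i) = 0" by simp
      then show False using nz p0[OF i] conjugate_square_eq_0_vec[OF p, of i] by (simp add: c_def)
    qed
  qed
  have ev: "A *\<^sub>v p i = J $$ (i, i) \<cdot>\<^sub>v p i" if "i < n" for i
    using that super by (intro eig) auto
  define b where "b i = Re (J $$ (i, i))" for i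
  have b: "J $$ (i, i) = complex_of_real (b i)" if "i < n" for i
    using hermitian_eigenvalue_real[OF A p p0[OF that] ev[OF that]] by (simp add: b_def)
  have J: "J = mat_diag n (\<lambda>i. complex_of_real (b i))" (is "_ = ?D")
  proof (rule eq_matI)
    fix i j assume "i < dim_row ?D" "j < dim_col ?D"
    then show "J $$ (i, j) = ?D $$ (i, j)"
      using J0[of i j] super[of i] b[of i] by (cases "j = Suc i") (auto simp: mat_diag_def)
  qed (use carrier_matD[OF w(5)] in \<open>auto simp: mat_diag_def\<close>)
  have "eigenvalue A (complex_of_real (b i))" if "i < n" for i
    unfolding eigenvalue_def eigenvector_def
    using carrier_matD[OF A(1)] p0[OF that] ev[OF that] b[OF that] by (intro exI[of _ "p i"]) simp
  with that[OF w(6,7,1,2) w(3)[unfolded J]] show ?thesis .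
qed

section \<open>Functional calculus of a Hermitian matrix\<close>

text \<open>\<open>F f\<close> is the matrix usually written \<open>f(A)\<close>. The spectrum is
  finite, so \<open>f\<close> may be any real function. The axioms are multiplicative, since roots,
  absolute values and generalized inverses are all characterized by products.\<close>

locale functional_calculus =
  fixes n :: nat and A :: "complex mat" and F :: "(real \<Rightarrow> real) \<Rightarrow> complex mat"
  assumes F_carrier [simp]: "F f \<in> carrier_mat n n"
    and F_hermitian [simp]: "hermitian_mat (F f)"
    and F_mult: "F f * F g = F (\<lambda>x. f x * g x)"
    and F_ident: "F (\<lambda>x. x) = A"
    and F_zero: "F (\<lambda>x. 0) = 0\<^sub>m n n"
    and F_cong: "(\<And>t. eigenvalue A (complex_of_real t) \<Longrightarrow> f t = g t) \<Longrightarrow> F f = F g"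

text \<open>The diagonalizing matrix \<open>P\<close> is not unitary. That \<open>F f = P f(B) Q\<close> is nevertheless Hermitian
  comes from \<open>G = P* P\<close> commuting with \<open>B\<close>, hence with \<open>f(B)\<close>.\<close>
lemma hermitian_functional_calculus:
  assumes A: "A \<in> carrier_mat n n" "hermitian_mat A"
  obtains F where "functional_calculus n A F"
proof -
  obtain P Q b where [simp]: "P \<in> carrier_mat n n" "Q \<in> carrier_mat n n"
    and PQ: "P * Q = 1\<^sub>m n" and QP: "Q * P = 1\<^sub>m n"
    and AB: "A = P * mat_diag n (\<lambda>i. complex_of_real (b i)) * Q"
    and ev: "\<And>i. i < n \<Longrightarrow> eigenvalue A (complex_of_real (b i))"
    using hermitian_diagonalizable[OF A] by blast
  define D where "D f = mat_diag n (\<lambda>i. complex_of_real (f (b i)))" for f :: "real \<Rightarrow> real"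
  define F where "F f = P * D f * Q" for f
  define G where "G = mat_adjoint P * P"
  have D [simp]: "D f \<in> carrier_mat n n" for f by (simp add: D_def)
  note assoc = assoc_mult_mat[of _ n n _ n _ n]
  note mc [simp] = mult_carrier_mat[of _ n n _ n]
  have G [simp]: "G \<in> carrier_mat n n" by (simp add: G_def)
  have Dadj: "mat_adjoint (D f) = D f" for f
    by (intro eq_matI) (auto simp: D_def mat_diag_def)
  have cancel: "Q * (P * M) = M" "P * (Q * M) = M" if "M \<in> carrier_mat n n" for M
    using that assoc_mult_mat[of Q n n P n M n] assoc_mult_mat[of P n n Q n M n] PQ QP by auto
  have cancel': "mat_adjoint P * (mat_adjoint Q * M) = M" "mat_adjoint Q * (mat_adjoint P * M) = M"
    if "M \<in> carrier_mat n n" for M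
  proof -
    have "mat_adjoint P * mat_adjoint Q = 1\<^sub>m n" "mat_adjoint Q * mat_adjoint P = 1\<^sub>m n"
      using mat_adjoint_mult[of Q n n P n, symmetric] mat_adjoint_mult[of P n n Q n, symmetric]
      by (simp_all add: PQ QP)
    then show "mat_adjoint P * (mat_adjoint Q * M) = M" "mat_adjoint Q * (mat_adjoint P * M) = M"
      using that assoc_mult_mat[of "mat_adjoint P" n n "mat_adjoint Q" n M n]
        assoc_mult_mat[of "mat_adjoint Q" n n "mat_adjoint P" n M n] by auto
  qed
  have Fadj: "mat_adjoint (F f) = mat_adjoint Q * (D f * mat_adjoint P)" for f
    by (simp add: F_def mat_adjoint_mult[of _ n n _ n] Dadj)
  \<comment> \<open>Both sides come from sandwiching \<open>A\<close> and its adjoint, which are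
    equal, between \<open>mat_adjoint P\<close> and \<open>P\<close>.\<close>
  have "D (\<lambda>x. x) * G = G * D (\<lambda>x. x)"
  proof -
    have "mat_adjoint P * (mat_adjoint (F (\<lambda>x. x)) * P) = mat_adjoint P * (F (\<lambda>x. x) * P)"
      using A(2) by (simp add: AB F_def D_def hermitian_mat_def)
    moreover have "mat_adjoint P * (mat_adjoint (F (\<lambda>x. x)) * P) = D (\<lambda>x. x) * G"
      by (simp add: Fadj G_def assoc cancel')
    moreover have "mat_adjoint P * (F (\<lambda>x. x) * P) = G * D (\<lambda>x. x)"
      by (simp add: F_def G_def assoc QP right_mult_one_mat[of _ n n])
    ultimately show ?thesis by simp
  qed
  then have "D f * G = G * D f" for f
  proof -
    assume *: "D (\<lambda>x. x) * G = G * D (\<lambda>x. x)"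
    have "complex_of_real (b i) * G $$ (i, j) = G $$ (i, j) * complex_of_real (b j)"
      if "i < n" "j < n" for i j
      using arg_cong[OF *, of "\<lambda>M. M $$ (i, j)"] that
      by (simp add: D_def mat_diag_mult_left[of G n n] mat_diag_mult_right[of G n n])
    \<comment> \<open>Thus \<open>G\<close> links only indices with equal \<open>b\<close>, hence
      with equal \<open>f (b i)\<close>, and so it commutes with every \<open>D f\<close>.\<close>
    then have "G $$ (i, j) = 0 \<or> b i = b j" if "i < n" "j < n" for i j
      using that by (metis mult.commute mult_left_cancel of_real_eq_iff)
    then show "D f * G = G * D f"
      unfolding D_def mat_diag_mult_left[OF G] mat_diag_mult_right[OF G]
      by (intro eq_matI) fastforce+
  qed
  have herm: "hermitian_mat (F f)" for f
  proof -
    \<comment> \<open>Inserting \<open>P * Q = 1\<close> produces \<open>G\<close>; once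
      \<open>G\<close> has moved to the left, \<open>mat_adjoint Q * mat_adjoint P\<close>
      cancels.\<close>
    have "mat_adjoint (F f) = mat_adjoint Q * (D f * G) * Q"
      by (simp add: Fadj G_def assoc PQ right_mult_one_mat[of _ n n])
    also have "\<dots> = F f"
      by (simp add: \<open>D f * G = G * D f\<close>) (simp add: G_def F_def assoc cancel')
    finally show ?thesis by (simp add: hermitian_mat_def)
  qed
  have mult: "F f * F g = F (\<lambda>x. f x * g x)" for f g
  proof -
    have "F f * F g = P * (D f * D g) * Q" by (simp add: F_def assoc cancel)
    then show ?thesis by (simp add: F_def D_def)
  qed
  have "D (\<lambda>x. 0) = 0\<^sub>m n n" by (intro eq_matI) (auto simp: D_def mat_diag_def)
  then have zero: "F (\<lambda>x. 0) = 0\<^sub>m n n"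
    by (simp add: F_def right_mult_zero_mat[of _ n n] left_mult_zero_mat[of _ n n])
  have cong: "F f = F g" if "\<And>t. eigenvalue A (complex_of_real t) \<Longrightarrow> f t = g t" for f g
  proof -
    have "D f = D g" using that ev by (intro eq_matI) (auto simp: D_def mat_diag_def)
    then show ?thesis by (simp add: F_def)
  qed
  have "functional_calculus n A F"
  proof (unfold_locales, goal_cases)
    case (6 f g)
    then show ?case by (rule cong)
  qed (simp_all add: herm mult zero, simp_all add: F_def D_def AB)
  then show ?thesis by (rule that)
qed

section \<open>Positive semidefinite matrices and their spectra\<close>

lemma psd_mat_hermitian: "psd_mat A \<Longrightarrow> hermitian_mat A"
  by (simp add: psd_mat_def)

lemma psd_matD:
  assumes "psd_mat A" "A \<in> carrier_mat n n" "x \<in> carrier_vec n"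
  shows "0 \<le> (A *\<^sub>v x) \<bullet>c x"
  using assms by (auto simp: psd_mat_def)

text \<open>The form at \<open>x\<close> is the squared norm of \<open>H x\<close>. Positivity of a
  matrix \<open>F f\<close> is later obtained by writing \<open>f\<close> as a square.\<close>

lemma psd_mat_square_hermitian:
  assumes H: "H \<in> carrier_mat n n" "hermitian_mat H"
  shows "psd_mat (H * H)"
  unfolding psd_mat_def
proof (intro conjI ballI)
  show "hermitian_mat (H * H)"
    using H by (simp add: hermitian_mat_def mat_adjoint_mult[of H n n H n])
  fix x :: "complex vec" assume "x \<in> carrier_vec (dim_row (H * H))"
  then have x: "x \<in> carrier_vec n" "H *\<^sub>v x \<in> carrier_vec n" using H by auto
  have "((H * H) *\<^sub>v x) \<bullet>c x = (H *\<^sub>v x) \<bullet>c (H *\<^sub>v x)"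
    using hermitian_cscalar_prod[OF H x(2,1)] H x by simp
  then show "0 \<le> ((H * H) *\<^sub>v x) \<bullet>c x" using conjugate_square_ge_0_vec[of "H *\<^sub>v x"] by simp
qed

lemma psd_mat_add:
  assumes "A \<in> carrier_mat n n" "B \<in> carrier_mat n n" "psd_mat A" "psd_mat B"
  shows "psd_mat (A + B)"
  unfolding psd_mat_def
proof (intro conjI ballI)
  show "hermitian_mat (A + B)" using assms by (intro hermitian_mat_add[of _ n] psd_mat_hermitian)
  fix x :: "complex vec" assume "x \<in> carrier_vec (dim_row (A + B))"
  then have x: "x \<in> carrier_vec n" using assms by auto
  then have "((A + B) *\<^sub>v x) \<bullet>c x = (A *\<^sub>v x) \<bullet>c x + (B *\<^sub>v x) \<bullet>c x"
    using assms by (simp add: add_mult_distrib_mat_vec[of _ n n] add_scalar_prod_distrib[of _ n])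
  then show "0 \<le> ((A + B) *\<^sub>v x) \<bullet>c x" using psd_matD[of _ n x] assms x by simp
qed

lemma eigenvalueE:
  assumes "eigenvalue A k" "A \<in> carrier_mat n n"
  obtains v where "v \<in> carrier_vec n" "v \<noteq> 0\<^sub>v n" "A *\<^sub>v v = k \<cdot>\<^sub>v v"
  using assms by (auto simp: eigenvalue_def eigenvector_def)

lemma psd_mat_eigenvalue_nonneg:
  assumes A: "A \<in> carrier_mat n n" "psd_mat A" and ev: "eigenvalue A (complex_of_real t)"
  shows "0 \<le> t"
proof -
  obtain v where v: "v \<in> carrier_vec n" "v \<noteq> 0\<^sub>v n" "A *\<^sub>v v = complex_of_real t \<cdot>\<^sub>v v"
    using eigenvalueE[OF ev A(1)] .
  have "0 \<le> complex_of_real t * (v \<bullet>c v)" using psd_matD[OF A(2,1) v(1)] v by simp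
  moreover have "0 < v \<bullet>c v" using v by simp
  ultimately show ?thesis by (auto simp: less_eq_complex_def less_complex_def zero_le_mult_iff)
qed

text \<open>If the spectrum is nonnegative, then \<open>A\<close> is the square of the Hermitian
  matrix \<open>F sqrt\<close>.\<close>

lemma psd_mat_iff_eigenvalues_nonneg:
  assumes A: "A \<in> carrier_mat n n" "hermitian_mat A"
  shows "psd_mat A \<longleftrightarrow> (\<forall>t. eigenvalue A (complex_of_real t) \<longrightarrow> 0 \<le> t)"
proof
  assume nonneg: "\<forall>t. eigenvalue A (complex_of_real t) \<longrightarrow> 0 \<le> t"
  obtain F where "functional_calculus n A F"
    using hermitian_functional_calculus[OF A] .
  then interpret functional_calculus n A F .
  have "F sqrt * F sqrt = A"
    unfolding F_mult F_ident[symmetric] using nonneg by (intro F_cong) simp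
  then show "psd_mat A" using psd_mat_square_hermitian[OF F_carrier[of sqrt] F_hermitian[of sqrt]] by simp
qed (use psd_mat_eigenvalue_nonneg[OF A(1)] in blast)

text \<open>With \<open>S = D + K\<close> and \<open>N = D - K\<close> one has \<open>N S + S N = 0\<close>. So \<open>\<langle>N v, v\<rangle> = 0\<close> for an eigenvector
  \<open>v\<close> of \<open>S\<close> with nonzero eigenvalue, and \<open>\<langle>S v, v\<rangle> = \<langle>(S + N) v, v\<rangle> = 2 \<langle>D v, v\<rangle>\<close> is nonnegative.\<close>
lemma psd_mat_add_of_square_eq:
  assumes D: "D \<in> carrier_mat n n" "psd_mat D" and K: "K \<in> carrier_mat n n" "hermitian_mat K"
    and DK: "D * D = K * K"
  shows "psd_mat (D + K)"
proof -
  note Dh = psd_mat_hermitian[OF D(2)]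
  define S N where "S = D + K" and "N = D - K"
  have [simp]: "S \<in> carrier_mat n n" "N \<in> carrier_mat n n"
    using D K by (auto simp: S_def N_def)
  have S: "hermitian_mat S" unfolding S_def by (intro hermitian_mat_add[of _ n] D K Dh)
  have NS: "N * S + S * N = 0\<^sub>m n n"
  proof -
    have "N * S = D * D + D * K - (K * D + K * K)" "S * N = D * D + K * D - (D * K + K * K)"
      using D K by (simp_all add: S_def N_def minus_mult_distrib_mat[of _ n n _ _ n]
          add_mult_distrib_mat[of _ n n _ _ n] mult_add_distrib_mat[of _ n n _ n]
          mult_minus_distrib_mat[of _ n n _ n])
    \<comment> \<open>\<open>X\<close> stands for the common square of \<open>D\<close> and
      \<open>K\<close>, and \<open>Y\<close>, \<open>Z\<close> for the products \<open>D * K\<close>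
      and \<open>K * D\<close>.\<close>
    moreover have "X + Y - (Z + X) + (X + Z - (Y + X)) = 0\<^sub>m n n"
      if "X \<in> carrier_mat n n" "Y \<in> carrier_mat n n" "Z \<in> carrier_mat n n"
      for X Y Z :: "complex mat"
      using that by (intro eq_matI) auto
    ultimately show ?thesis using D K by (simp add: DK mult_carrier_mat[of _ n n _ n])
  qed
  have "0 \<le> t" if ev: "eigenvalue S (complex_of_real t)" for t
  proof (cases "t = 0")
    case False
    obtain v where v: "v \<in> carrier_vec n" "v \<noteq> 0\<^sub>v n" "S *\<^sub>v v = complex_of_real t \<cdot>\<^sub>v v"
      using eigenvalueE[OF ev, of n] by auto
    have [simp]: "M *\<^sub>v v \<in> carrier_vec n" if "M \<in> carrier_mat n n" for M
      using that v by simp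
    let ?a = "(N *\<^sub>v v) \<bullet>c v"
    have "0\<^sub>m n n *\<^sub>v v = 0\<^sub>v n" using v(1) by (intro eq_vecI) auto
    then have "((N * S + S * N) *\<^sub>v v) \<bullet>c v = 0"
      using v by (simp add: NS)
    then have "(N *\<^sub>v (S *\<^sub>v v)) \<bullet>c v + (S *\<^sub>v (N *\<^sub>v v)) \<bullet>c v = 0"
      using v by (simp add: add_mult_distrib_mat_vec[of _ n n] add_scalar_prod_distrib[of _ n]
          assoc_mult_mat_vec[of _ n n _ n] mult_carrier_mat[of _ n n] mult_mat_vec_carrier[of _ n n])
    moreover have "(N *\<^sub>v (S *\<^sub>v v)) \<bullet>c v = t * ?a"
      using v by (simp add: mult_mat_vec[of _ n n] smult_scalar_prod_distrib[of _ n])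
    moreover have "(S *\<^sub>v (N *\<^sub>v v)) \<bullet>c v = t * ?a"
      using v S by (simp add: hermitian_cscalar_prod[of S n] conjugate_smult_vec
          scalar_prod_smult_distrib[of _ n])
    ultimately have "?a = 0" using False by simp
    then have eq: "(D *\<^sub>v v) \<bullet>c v = (K *\<^sub>v v) \<bullet>c v"
      using v D K by (simp add: N_def minus_mult_distrib_mat_vec[of _ n n]
          minus_scalar_prod_distrib[of _ n])
    have "(S *\<^sub>v v) \<bullet>c v = (D *\<^sub>v v) \<bullet>c v + (K *\<^sub>v v) \<bullet>c v"
      using v(1) D K by (simp add: S_def add_mult_distrib_mat_vec[of _ n n]
          add_scalar_prod_distrib[of _ n])
    then have "t * (v \<bullet>c v) = (D *\<^sub>v v) \<bullet>c v + (D *\<^sub>v v) \<bullet>c v"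
      using v by (simp add: eq)
    then have "0 \<le> t * (v \<bullet>c v)" using psd_matD[OF D(2,1) v(1)]
      by (metis add_nonneg_nonneg)
    moreover have "0 < v \<bullet>c v" using v by simp
    ultimately show ?thesis by (auto simp: less_eq_complex_def less_complex_def zero_le_mult_iff)
  qed simp
  then show ?thesis
    using psd_mat_iff_eigenvalues_nonneg[of S n] S \<open>S \<in> carrier_mat n n\<close>
    unfolding S_def by blast
qed

section \<open>Uniqueness and existence of positive semidefinite square roots\<close>

text \<open>The preceding lemma, applied to \<open>B\<close> with \<open>- C\<close> and to
  \<open>C\<close> with \<open>- B\<close>, makes both \<open>X = B - C\<close> and
  \<open>- X\<close> positive semidefinite. So 0 is the only possible eigenvalue of
  \<open>X\<close>, and the functional calculus gives \<open>X = 0\<close>.\<close>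

lemma psd_mat_square_inj:
  assumes B: "B \<in> carrier_mat n n" "psd_mat B" and C: "C \<in> carrier_mat n n" "psd_mat C"
    and BC: "B * B = C * C"
  shows "B = C"
proof -
  note Bh = psd_mat_hermitian[OF B(2)] and Ch = psd_mat_hermitian[OF C(2)]
  define X where "X = B - C"
  have X [simp]: "X \<in> carrier_mat n n" "hermitian_mat X"
    using B C Bh Ch by (auto simp: X_def intro!: hermitian_mat_minus[of _ n])
  have sq: "(- M) * (- M) = M * M" if "M \<in> carrier_mat n n" for M :: "complex mat"
    using that by (intro eq_matI) (auto simp: scalar_prod_def)
  have X': "psd_mat X"
  proof -
    have "psd_mat (B + - C)"
      using B C BC Ch by (intro psd_mat_add_of_square_eq[of _ n]) (auto simp: sq hermitian_mat_uminus)
    then show ?thesis using B C by (simp add: X_def minus_add_uminus_mat[of _ n n])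
  qed
  have X'': "psd_mat (- X)"
  proof -
    have "psd_mat (C + - B)"
      using B C BC Bh by (intro psd_mat_add_of_square_eq[of _ n]) (auto simp: sq hermitian_mat_uminus)
    also have "C + - B = - X" using B C by (intro eq_matI) (auto simp: X_def)
    finally show ?thesis .
  qed
  have ev: "t = 0" if evt: "eigenvalue X (complex_of_real t)" for t
  proof -
    obtain v where v: "v \<in> carrier_vec n" "v \<noteq> 0\<^sub>v n" "X *\<^sub>v v = complex_of_real t \<cdot>\<^sub>v v"
      using eigenvalueE[OF evt X(1)] .
    then have "(- X) *\<^sub>v v = complex_of_real (- t) \<cdot>\<^sub>v v"
      using carrier_matD[OF X(1)] by (intro eq_vecI) auto
    then have "eigenvalue (- X) (complex_of_real (- t))"
      unfolding eigenvalue_def eigenvector_def using v carrier_matD[OF X(1)]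
      by (intro exI[of _ v]) simp
    then show ?thesis
      using psd_mat_eigenvalue_nonneg[OF _ X'', of n "- t"]
        psd_mat_eigenvalue_nonneg[OF X(1) X' evt] X(1) by simp
  qed
  obtain F where "functional_calculus n X F"
    using hermitian_functional_calculus[OF X] .
  then interpret functional_calculus n X F .
  have "X = 0\<^sub>m n n" using F_cong[of "\<lambda>x. x" "\<lambda>x. 0"] ev F_ident F_zero by simp
  then have "(B - C) $$ (i, j) = 0" if "i < n" "j < n" for i j using that by (simp add: X_def)
  then show ?thesis using B C by (intro eq_matI) auto
qed

text \<open>By uniqueness of the root, \<open>D\<close> is \<open>F abs\<close>, a function of
  \<open>K\<close>, and functions of \<open>K\<close> commute.\<close>

lemma psd_mat_square_eq_commute:
  assumes D: "D \<in> carrier_mat n n" "psd_mat D" and K: "K \<in> carrier_mat n n" "hermitian_mat K"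
    and DK: "D * D = K * K"
  shows "D * K = K * D"
proof -
  obtain F where "functional_calculus n K F"
    using hermitian_functional_calculus[OF K] .
  then interpret functional_calculus n K F .
  have "psd_mat (F (\<lambda>x. sqrt \<bar>x\<bar>) * F (\<lambda>x. sqrt \<bar>x\<bar>))"
    by (intro psd_mat_square_hermitian[of _ n]) auto
  then have "psd_mat (F abs)" by (simp add: F_mult)
  moreover have "D * D = F abs * F abs" unfolding DK F_ident[symmetric] by (simp add: F_mult)
  ultimately have "D = F abs" using psd_mat_square_inj[OF D F_carrier] by blast
  then show ?thesis unfolding F_ident[symmetric] by (simp add: F_mult mult.commute)
qed

text \<open>Existence comes from the functional calculus and uniqueness from
  \<open>psd_mat_square_inj\<close>; together they justify the definite description in
  \<open>psd_sqrt\<close>.\<close>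

lemma psd_sqrt:
  assumes A: "A \<in> carrier_mat n n" "psd_mat A"
  shows "psd_mat (psd_sqrt A)" "psd_sqrt A * psd_sqrt A = A" "psd_sqrt A \<in> carrier_mat n n"
proof -
  obtain F where "functional_calculus n A F"
    using hermitian_functional_calculus[OF A(1) psd_mat_hermitian[OF A(2)]] .
  then interpret functional_calculus n A F .
  \<comment> \<open>The fourth root exhibits the square root as a square of a Hermitian matrix. The
    absolute value makes this identity hold at every real argument, not only on the
    spectrum.\<close>
  have "psd_mat (F (\<lambda>x. sqrt (sqrt \<bar>x\<bar>)) * F (\<lambda>x. sqrt (sqrt \<bar>x\<bar>)))"
    by (intro psd_mat_square_hermitian[of _ n]) auto
  then have R: "psd_mat (F (\<lambda>x. sqrt \<bar>x\<bar>))" by (simp add: F_mult)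
  have RR: "F (\<lambda>x. sqrt \<bar>x\<bar>) * F (\<lambda>x. sqrt \<bar>x\<bar>) = A"
    unfolding F_mult F_ident[symmetric] using psd_mat_eigenvalue_nonneg[OF A] by (intro F_cong) simp
  have carrier: "B \<in> carrier_mat n n" if "psd_mat B" "B * B = A" for B
    using hermitian_mat_square[OF psd_mat_hermitian[OF that(1)]] that(2) A(1)
    by (metis carrier_matD(1) index_mult_mat(2))
  have "\<exists>!B. psd_mat B \<and> B * B = A"
  proof (rule ex1I[of _ "F (\<lambda>x. sqrt \<bar>x\<bar>)"])
    fix B assume B: "psd_mat B \<and> B * B = A"
    show "B = F (\<lambda>x. sqrt \<bar>x\<bar>)"
      using B R RR by (intro psd_mat_square_inj[of B n] carrier) auto
  qed (use R RR in auto)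
  from theI'[OF this] have "psd_mat (psd_sqrt A) \<and> psd_sqrt A * psd_sqrt A = A"
    unfolding psd_sqrt_def .
  then show "psd_mat (psd_sqrt A)" "psd_sqrt A * psd_sqrt A = A" by blast+
  then show "psd_sqrt A \<in> carrier_mat n n" by (rule carrier)
qed

lemma psd_mat_adjoint_mult:
  assumes T: "T \<in> carrier_mat m n"
  shows "psd_mat (mat_adjoint T * T)"
  unfolding psd_mat_def
proof (intro conjI ballI)
  show "hermitian_mat (mat_adjoint T * T)"
    using T by (simp add: hermitian_mat_def mat_adjoint_mult[of _ n m _ n])
  fix x :: "complex vec" assume "x \<in> carrier_vec (dim_row (mat_adjoint T * T))"
  then have x: "x \<in> carrier_vec n" using T by auto
  have "((mat_adjoint T * T) *\<^sub>v x) \<bullet>c x = (T *\<^sub>v x) \<bullet>c (T *\<^sub>v x)"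
    using T x cscalar_prod_adjoint[of "mat_adjoint T" n m "T *\<^sub>v x" x]
    by (simp add: assoc_mult_mat_vec[of _ n m _ n])
  then show "0 \<le> ((mat_adjoint T * T) *\<^sub>v x) \<bullet>c x"
    using conjugate_square_ge_0_vec[of "T *\<^sub>v x"] by simp
qed

lemma mat_abs:
  assumes T: "T \<in> carrier_mat m n"
  shows "psd_mat (mat_abs T)" "mat_abs T * mat_abs T = mat_adjoint T * T"
    "mat_abs T \<in> carrier_mat n n"
  using psd_sqrt[OF mult_carrier_mat[OF mat_adjoint_carrier[OF T] T] psd_mat_adjoint_mult[OF T]]
  unfolding mat_abs_def by auto

section \<open>Generalized inverses and block matrices\<close>

text \<open>Applied to \<open>|T*|\<close>, this allows \<open>Q (Q z) = Q y\<close> to be solved by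
  \<open>z = Z y\<close> even when \<open>Q\<close> is singular.\<close>

lemma hermitian_square_mult_inverse:
  assumes A: "A \<in> carrier_mat n n" "hermitian_mat A"
  obtains Z where "Z \<in> carrier_mat n n" "A * (A * Z) = A"
proof -
  obtain F where "functional_calculus n A F"
    using hermitian_functional_calculus[OF A] .
  then interpret functional_calculus n A F .
  \<comment> \<open>At \<open>x = 0\<close> the identity relies on the convention
    \<open>inverse 0 = 0\<close>.\<close>
  have "F (\<lambda>x. x * (x * inverse x)) = F (\<lambda>x. x)"
    by (rule arg_cong[of _ _ F]) (auto simp: field_simps)
  then have "A * (A * F inverse) = A"
    unfolding F_ident[symmetric] by (simp only: F_mult)
  then show ?thesis by (intro that[OF F_carrier])
qed

lemma conjugate_append_vec: "conjugate (v @\<^sub>v w) = conjugate v @\<^sub>v conjugate w"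
  by (intro eq_vecI) auto

lemma cscalar_prod_append:
  assumes "v1 \<in> carrier_vec n" "v2 \<in> carrier_vec m" "w1 \<in> carrier_vec n" "w2 \<in> carrier_vec m"
  shows "(v1 @\<^sub>v v2) \<bullet>c (w1 @\<^sub>v w2) = v1 \<bullet>c w1 + v2 \<bullet>c w2"
  using assms by (simp add: conjugate_append_vec scalar_prod_append[of _ n _ m])

lemma psd_mat_four_block_diag:
  assumes A: "A \<in> carrier_mat n n" "psd_mat A" and B: "B \<in> carrier_mat m m" "psd_mat B"
  shows "psd_mat (four_block_mat A (0\<^sub>m n m) (0\<^sub>m m n) B)"
  unfolding psd_mat_def
proof (intro conjI ballI)
  show "hermitian_mat (four_block_mat A (0\<^sub>m n m) (0\<^sub>m m n) B)"
    using A B psd_mat_hermitian[of A] psd_mat_hermitian[of B]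
    by (simp add: hermitian_mat_def mat_adjoint_four_block[of _ n n _ m _ m])
  fix x :: "complex vec"
  assume "x \<in> carrier_vec (dim_row (four_block_mat A (0\<^sub>m n m) (0\<^sub>m m n) B))"
  then have "x \<in> carrier_vec (n + m)" using A B by simp
  then obtain y z where x: "x = y @\<^sub>v z" and y: "y \<in> carrier_vec n" and z: "z \<in> carrier_vec m"
    by (metis vec_first_carrier vec_first_last_append vec_last_carrier)
  have "(four_block_mat A (0\<^sub>m n m) (0\<^sub>m m n) B *\<^sub>v x) \<bullet>c x = (A *\<^sub>v y) \<bullet>c y + (B *\<^sub>v z) \<bullet>c z"
    using A B y z by (simp add: x mult_mat_vec_split cscalar_prod_append[of _ n _ m])
  then show "0 \<le> (four_block_mat A (0\<^sub>m n m) (0\<^sub>m m n) B *\<^sub>v x) \<bullet>c x"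
    using psd_matD[OF A(2,1) y] psd_matD[OF B(2,1) z] by simp
qed

text \<open>Both \<open>D * D\<close> and \<open>K * K\<close> are block diagonal with blocks
  \<open>T* T\<close> and \<open>T T*\<close>. Positivity of \<open>D + K\<close> is the first
  claim, and the upper right block of \<open>D K = K D\<close> is the second.\<close>

lemma mat_abs_block:
  assumes T: "T \<in> carrier_mat m n"
  shows psd_mat_abs_block:
      "psd_mat (four_block_mat (mat_abs T) (mat_adjoint T) T (mat_abs (mat_adjoint T)))"
    and mat_abs_intertwine: "mat_abs T * mat_adjoint T = mat_adjoint T * mat_abs (mat_adjoint T)"
proof -
  let ?S = "mat_adjoint T" and ?P = "mat_abs T" and ?Q = "mat_abs (mat_adjoint T)"
  have S: "?S \<in> carrier_mat n m" using T by simp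
  note P = mat_abs[OF T] and Q = mat_abs[OF S, unfolded mat_adjoint_adjoint]
  define D where "D = four_block_mat ?P (0\<^sub>m n m) (0\<^sub>m m n) ?Q"
  define K where "K = four_block_mat (0\<^sub>m n n) ?S T (0\<^sub>m m m)"
  note mult = mult_four_block_mat[of _ n n _ m _ m _ _ n _ m]
  note zero = left_mult_zero_mat[of _ n] left_mult_zero_mat[of _ m]
    right_mult_zero_mat[of _ n] right_mult_zero_mat[of _ m]
  have D: "D \<in> carrier_mat (n + m) (n + m)" "psd_mat D"
    using P Q by (auto simp: D_def intro!: psd_mat_four_block_diag)
  have K: "K \<in> carrier_mat (n + m) (n + m)" "hermitian_mat K"
    using S T
    by (auto simp: K_def hermitian_mat_def mat_adjoint_four_block[of _ n n _ m _ m])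
  have [simp]: "?S * T \<in> carrier_mat n n" "T * ?S \<in> carrier_mat m m"
    "?P * ?S \<in> carrier_mat n m" "?Q * T \<in> carrier_mat m n"
    "?S * ?Q \<in> carrier_mat n m" "T * ?P \<in> carrier_mat m n"
    using P(3) Q(3) S T by auto
  have DK: "D * D = K * K"
    using P Q S T by (simp add: D_def K_def mult zero)
  show "psd_mat (four_block_mat ?P ?S T ?Q)"
  proof -
    have "D + K = four_block_mat ?P ?S T ?Q"
      using P(3) Q(3) S T by (simp add: D_def K_def add_four_block_mat[of _ n n _ m _ m])
    then show ?thesis using psd_mat_add_of_square_eq[OF D K DK] by simp
  qed
  have "four_block_mat (0\<^sub>m n n) (?P * ?S) (?Q * T) (0\<^sub>m m m) =
      four_block_mat (0\<^sub>m n n) (?S * ?Q) (T * ?P) (0\<^sub>m m m)" (is "?L = ?R")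
    using psd_mat_square_eq_commute[OF D K DK] P(3) Q(3) S T
    by (simp add: D_def K_def mult zero)
  \<comment> \<open>The column offset \<open>n\<close> selects the upper right blocks.\<close>
  then have entry: "?L $$ (i, j + n) = ?R $$ (i, j + n)" for i j by simp
  have "(?P * ?S) $$ (i, j) = (?S * ?Q) $$ (i, j)" if "i < n" "j < m" for i j
    using entry[of i j] that carrier_matD[OF P(3)] carrier_matD[OF Q(3)] carrier_matD[OF T]
    by (simp del: index_mult_mat(1))
  then show "?P * ?S = ?S * ?Q"
    using P(3) Q(3) S by (intro eq_matI) (auto simp del: index_mult_mat(1))
qed

section \<open>Positivity of the block matrix compared with semi-hyponormality\<close>

theorem theorem3p1:
  fixes T :: "complex mat" and n :: nat
  assumes "T \<in> carrier_mat n n"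
  shows "psd_mat (four_block_mat (mat_abs T) (mat_adjoint T) T (mat_abs T))
           \<longleftrightarrow> semi_hyponormal T"
proof -
  define S P Q where "S = mat_adjoint T" and "P = mat_abs T" and "Q = mat_abs S"
  note T [simp] = assms
  have S [simp]: "S \<in> carrier_mat n n" by (simp add: S_def)
  have P: "psd_mat P" and P' [simp]: "P \<in> carrier_mat n n"
    using mat_abs[OF T] by (simp_all add: P_def)
  have Q: "psd_mat Q" "Q * Q = T * S" and Q' [simp]: "Q \<in> carrier_mat n n"
    using mat_abs[OF S] by (simp_all add: Q_def) (simp add: S_def)
  have PS: "P * S = S * Q" using mat_abs_intertwine[OF T] by (simp add: P_def Q_def S_def)
  have PQ' [simp]: "P - Q \<in> carrier_mat n n" by (intro minus_carrier_mat Q')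
  let ?M = "four_block_mat P S T P"
  have semi: "semi_hyponormal T \<longleftrightarrow> psd_mat (P - Q)"
    using carrier_matD[OF P'] carrier_matD[OF Q'] psd_mat_hermitian[OF P] psd_mat_hermitian[OF Q(1)]
    by (simp add: semi_hyponormal_def loewner_le_def P_def Q_def S_def)
  have "psd_mat ?M \<longleftrightarrow> psd_mat (P - Q)"
  proof
    assume PQ: "psd_mat (P - Q)"
    have "psd_mat (four_block_mat P S T Q)"
      using psd_mat_abs_block[OF T] by (simp add: P_def Q_def S_def)
    moreover have "psd_mat (0\<^sub>m n n)"
      using psd_mat_square_hermitian[of "0\<^sub>m n n" n] by (simp add: hermitian_mat_def)
    then have "psd_mat (four_block_mat (0\<^sub>m n n) (0\<^sub>m n n) (0\<^sub>m n n) (P - Q))"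
      using PQ by (intro psd_mat_four_block_diag) simp_all
    ultimately have "psd_mat
        (four_block_mat P S T Q + four_block_mat (0\<^sub>m n n) (0\<^sub>m n n) (0\<^sub>m n n) (P - Q))"
      by (intro psd_mat_add[of _ "n + n"] four_block_carrier_mat) simp_all
    also have "four_block_mat P S T Q + four_block_mat (0\<^sub>m n n) (0\<^sub>m n n) (0\<^sub>m n n) (P - Q) =
        four_block_mat P S T (Q + (P - Q))"
      by (simp add: add_four_block_mat[of _ n n _ n _ n])
    also have "Q + (P - Q) = P"
      using carrier_matD[OF P'] carrier_matD[OF Q'] by (intro eq_matI) auto
    finally show "psd_mat ?M" .
  next
    assume M: "psd_mat ?M"
    obtain Z where Z [simp]: "Z \<in> carrier_mat n n" and QQZ: "Q * (Q * Z) = Q"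
      using hermitian_square_mult_inverse[OF Q' psd_mat_hermitian[OF Q(1)]] .
    note vc [simp] = mult_mat_vec_carrier[of _ n n]
    have "0 \<le> ((P - Q) *\<^sub>v y) \<bullet>c y" if y [simp]: "y \<in> carrier_vec n" for y
    proof -
      \<comment> \<open>\<open>x\<close> is the first component of the test vector, and
        \<open>u\<close> is the residue of \<open>y\<close> after subtracting \<open>Q Z y\<close>;
        it is shown to lie in the kernel of \<open>Q\<close>.\<close>
      define z x u where "z = Z *\<^sub>v y" and "x = - (S *\<^sub>v z)" and "u = y - Q *\<^sub>v z"
      have z [simp]: "z \<in> carrier_vec n" and x [simp]: "x \<in> carrier_vec n"
        and u [simp]: "u \<in> carrier_vec n" by (simp_all add: z_def x_def u_def)
      have TS: "T *\<^sub>v (S *\<^sub>v w) = Q *\<^sub>v (Q *\<^sub>v w)" if "w \<in> carrier_vec n" for w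
        using that assoc_mult_mat_vec[OF T S that] assoc_mult_mat_vec[OF Q' Q' that] Q(2) by simp
      have Qz: "Q *\<^sub>v (Q *\<^sub>v z) = Q *\<^sub>v y"
      proof -
        have "(Q * (Q * Z)) *\<^sub>v y = Q *\<^sub>v (Q *\<^sub>v z)"
          by (simp add: z_def assoc_mult_mat_vec[of _ n n _ n] mult_carrier_mat[of _ n n _ n])
        then show ?thesis by (simp add: QQZ)
      qed
      have uminus: "A *\<^sub>v - w = - (A *\<^sub>v w)"
        if "A \<in> carrier_mat n n" "w \<in> carrier_vec n" for A :: "complex mat" and w
        using that by (intro eq_vecI) auto
      have Qu: "Q *\<^sub>v u = 0\<^sub>v n"
        by (simp add: u_def mult_minus_distrib_mat_vec[of _ n n] Qz)
      have PS': "P *\<^sub>v (S *\<^sub>v z) = S *\<^sub>v (Q *\<^sub>v z)"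
        using assoc_mult_mat_vec[OF P' S z] assoc_mult_mat_vec[OF S Q' z] PS by simp
      \<comment> \<open>The two block rows of the image of the test vector: the intertwining
        relation reduces the first to \<open>S u\<close>, and \<open>T S = Q Q\<close> reduces the
        second to \<open>(P - Q) y\<close>.\<close>
      have "P *\<^sub>v x + S *\<^sub>v y = S *\<^sub>v u"
        unfolding x_def u_def
        by (simp add: uminus PS' mult_minus_distrib_mat_vec[of _ n n])
          (use carrier_matD[OF S] in \<open>intro eq_vecI; auto\<close>)
      moreover have "T *\<^sub>v x + P *\<^sub>v y = (P - Q) *\<^sub>v y"
        unfolding x_def
        by (simp add: uminus TS Qz minus_mult_distrib_mat_vec[of _ n n])
          (use carrier_matD[OF P'] carrier_matD[OF Q'] in \<open>intro eq_vecI; auto\<close>)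
      moreover have "?M *\<^sub>v (x @\<^sub>v y) = (P *\<^sub>v x + S *\<^sub>v y) @\<^sub>v (T *\<^sub>v x + P *\<^sub>v y)"
        by (intro four_block_mat_mult_vec[of _ n n _ n _ n]) simp_all
      ultimately have "(?M *\<^sub>v (x @\<^sub>v y)) \<bullet>c (x @\<^sub>v y) = (S *\<^sub>v u) \<bullet>c x + ((P - Q) *\<^sub>v y) \<bullet>c y"
        by (simp add: cscalar_prod_append[of _ n _ n])
      \<comment> \<open>Moving \<open>S\<close> across gives \<open>T x\<close>, which lies in the
        range of \<open>Q\<close> and is therefore orthogonal to the kernel vector
        \<open>u\<close>.\<close>
      moreover have "(S *\<^sub>v u) \<bullet>c x = 0"
      proof -
        have "(S *\<^sub>v u) \<bullet>c x = u \<bullet>c (T *\<^sub>v x)"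
          using cscalar_prod_adjoint[OF S u x] by (simp add: S_def)
        also have "T *\<^sub>v x = Q *\<^sub>v (- (Q *\<^sub>v z))" by (simp add: x_def uminus TS)
        also have "u \<bullet>c \<dots> = (Q *\<^sub>v u) \<bullet>c (- (Q *\<^sub>v z))"
          using hermitian_cscalar_prod[OF Q' psd_mat_hermitian[OF Q(1)] u] by simp
        finally show ?thesis by (simp add: Qu scalar_prod_left_zero[of _ n])
      qed
      ultimately show ?thesis
        using psd_matD[OF M, of "n + n" "x @\<^sub>v y"] by simp
    qed
    then show "psd_mat (P - Q)"
      using hermitian_mat_minus[OF P' Q' psd_mat_hermitian[OF P] psd_mat_hermitian[OF Q(1)]]
        carrier_matD[OF Q']
      by (simp add: psd_mat_def)
  qed
  then show ?thesis by (simp add: semi P_def S_def)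
qed

end
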